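(* Let $q$ be a prime power and let $f\in\mathbb{F}_q[x]$ be a polynomial of degree $m\geq 1$. Then $f$ is a normal polynomial over $\mathbb{F}_q$ if and only if $f$ is monic and $\mathrm{Ord}(f)=x^m-1$.
   Context: For $h(x)=\sum_i a_i x^i\in\mathbb{F}_q[x]$, write $h\circ x=\sum_i a_i x^{q^i}\in\mathbb{F}_q[x]$ (the linearized $q$-associate of $h$). For $f\in\mathbb{F}_q[x]$ of degree at least $1$, the $\mathbb{F}_q$-Order $\mathrm{Ord}(f)$ is the monic polynomial $h\in\mathbb{F}_q[x]$ of least degree such that $f\mid h\circ x$ in $\mathbb{F}_q[x]$. An element $\alpha\in\mathbb{F}_{q^m}$ is normal over $\mathbb{F}_q$ if $\{\alpha,\alpha^q,\dots,\alpha^{q^{m-1}}\}$ is a basis of $\mathbb{F}_{q^m}$ over $\mathbb{F}_q$. A polynomial of degree $m$ in $\mathbb{F}_q[x]$ is called normal over $\mathbb{F}_q$ if it is the minimal polynomial over $\mathbb{F}_q$ of a normal element of $\mathbb{F}_{q^m}$ over $\mathbb{F}_q$. *)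

theory Defs
  imports
    "HOL-Algebra.Algebraic_Closure_Type"
    "HOL-Computational_Algebra.Computational_Algebra"
    "HOL-Library.Cardinality"
begin

text \<open>
  The ground field is the type \<^typ>\<open>'a::finite_field\<close>; its cardinality \<open>q = CARD('a)\<close>
  is a prime power, and every prime power arises in this way.
\<close>

section \<open>Linearized associates and orders\<close>

definition q_associate :: "'a::finite_field poly \<Rightarrow> 'a poly" where
  "q_associate h = (\<Sum>i\<le>degree h. monom (coeff h i) (CARD('a) ^ i))"

definition is_Fq_Order :: "'a::finite_field poly \<Rightarrow> 'a poly \<Rightarrow> bool" where
  "is_Fq_Order f h \<longleftrightarrow>
     is_arg_min degree (\<lambda>h. lead_coeff h = 1 \<and> f dvd q_associate h) h"

text \<open>For nonzero \<open>f\<close> there is exactly one such polynomial; see \<open>ex1_Fq_Order\<close> below.\<close>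

definition Fq_Order :: "'a::finite_field poly \<Rightarrow> 'a poly" where
  "Fq_Order f = (THE h. is_Fq_Order f h)"


section \<open>Normal elements and normal polynomials\<close>

text \<open>
  The extension of degree \<open>m\<close> is realized inside the algebraic closure as the set of roots
  of \<open>x ^ (q ^ m) - x\<close>. For \<open>m \<ge> 1\<close> this is the subfield with \<open>q ^ m\<close> elements
  (see \<open>card_ext_field\<close> and the closure lemmas below).
\<close>

definition ext_field :: "nat \<Rightarrow> 'a::finite_field alg_closure set" where
  "ext_field m = {x. x ^ (CARD('a) ^ m) = x}"

definition ac_scale :: "'a::field \<Rightarrow> 'a alg_closure \<Rightarrow> 'a alg_closure" where
  "ac_scale c x = to_ac c * x"

interpretation ac: vector_space "ac_scale :: 'a::field \<Rightarrow> 'a alg_closure \<Rightarrow> 'a alg_closure"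
  by standard (simp_all add: ac_scale_def algebra_simps)

text \<open>
  The conjugates are taken as a set. If two of them coincided, the set would have fewer than
  \<open>m\<close> elements and could not span the \<open>m\<close>-dimensional space \<open>ext_field m\<close>.
\<close>

definition normal_element :: "nat \<Rightarrow> 'a::finite_field alg_closure \<Rightarrow> bool" where
  "normal_element m \<alpha> \<longleftrightarrow> \<alpha> \<in> ext_field m \<and>
     (let B = (\<lambda>i. \<alpha> ^ (CARD('a) ^ i)) ` {..<m}
      in ac.independent B \<and> ac.span B = ext_field m)"

definition is_min_poly :: "'a::field alg_closure \<Rightarrow> 'a poly \<Rightarrow> bool" where
  "is_min_poly \<alpha> f \<longleftrightarrow>
     is_arg_min degree (\<lambda>g. lead_coeff g = 1 \<and> poly (map_poly to_ac g) \<alpha> = 0) f"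

definition normal_poly :: "'a::finite_field poly \<Rightarrow> bool" where
  "normal_poly f \<longleftrightarrow> (\<exists>\<alpha>. normal_element (degree f) \<alpha> \<and> is_min_poly \<alpha> f)"


section \<open>Basic consequences\<close>

lemma q_associate_altdef:
  fixes h :: "'a::finite_field poly"
  assumes "degree h \<le> n"
  shows "q_associate h = (\<Sum>i\<le>n. monom (coeff h i) (CARD('a) ^ i))"
  unfolding q_associate_def using assms
  by (intro sum.mono_neutral_left) (auto simp: coeff_eq_0)

lemma q_associate_diff:
  fixes g h :: "'a::finite_field poly"
  shows "q_associate (g - h) = q_associate g - q_associate h"
proof -
  define n where "n = max (degree g) (degree h)"
  have "degree (g - h) \<le> n" "degree g \<le> n" "degree h \<le> n"
    by (auto simp: n_def degree_diff_le_max)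
  thus ?thesis
    by (simp add: q_associate_altdef[of _ n] diff_monom [symmetric] sum_subtractf)
qed

lemma q_associate_smult:
  fixes h :: "'a::finite_field poly"
  shows "q_associate (smult c h) = smult c (q_associate h)"
proof -
  have "degree (smult c h) \<le> degree h" by (rule degree_smult_le)
  thus ?thesis
    by (intro poly_eqI) (simp add: q_associate_altdef[of _ "degree h"] coeff_sum sum_distrib_left if_distrib cong: if_cong)
qed

lemma q_associate_monom:
  "q_associate (monom c n :: 'a::finite_field poly) = monom c (CARD('a) ^ n)"
proof -
  have "q_associate (monom c n) = (\<Sum>i\<le>n. monom (coeff (monom c n) i) (CARD('a) ^ i))"
    by (rule q_associate_altdef) (rule degree_monom_le)
  also have "\<dots> = (\<Sum>i\<in>{n}. monom (coeff (monom c n) i) (CARD('a) ^ i))"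
    by (rule sum.mono_neutral_right) auto
  finally show ?thesis by simp
qed

lemma finite_degree_less: "finite {p :: 'a::{finite,zero} poly. degree p < n}"
proof (rule inj_on_finite)
  show "inj_on coeffs {p :: 'a poly. degree p < n}"
    by (rule inj_onI) (simp add: coeffs_eq_iff)
  have "length (coeffs p) \<le> n" if "degree p < n" for p :: "'a poly"
    using that by (cases "p = 0") (simp_all add: length_coeffs)
  thus "coeffs ` {p :: 'a poly. degree p < n} \<subseteq> {xs. set xs \<subseteq> UNIV \<and> length xs \<le> n}"
    by blast
  show "finite {xs :: 'a list. set xs \<subseteq> UNIV \<and> length xs \<le> n}"
    by (rule finite_lists_length_le) simp
qed

lemma ex1_Fq_Order:
  fixes f :: "'a::finite_field poly"
  assumes "f \<noteq> 0"
  shows "\<exists>!h. is_Fq_Order f h"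
proof -
  let ?P = "\<lambda>h. lead_coeff h = 1 \<and> f dvd q_associate h"
  have "\<exists>i j. i < j \<and> monom 1 (CARD('a) ^ i) mod f = monom 1 (CARD('a) ^ j) mod f"
  proof -
    let ?g = "\<lambda>i. monom (1::'a) (CARD('a) ^ i) mod f"
    have "finite (range ?g)"
    proof (rule finite_subset[OF _ finite_degree_less])
      show "range ?g \<subseteq> {p. degree p < Suc (degree f)}"
      proof safe
        fix i
        show "degree (?g i) < Suc (degree f)"
          using degree_mod_less[OF assms, of "monom 1 (CARD('a) ^ i)"] by auto
      qed
    qed
    hence "\<not> inj ?g"
      using finite_imageD by auto
    then obtain i j where "?g i = ?g j" "i \<noteq> j"
      by (auto simp: inj_def)
    thus ?thesis
      by (metis nat_neq_iff)
  qed
  then obtain i j where ij: "i < j" "monom 1 (CARD('a) ^ i) mod f = monom 1 (CARD('a) ^ j) mod f"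
    by blast
  define h0 where "h0 = monom (1::'a) j - monom 1 i"
  have "lead_coeff h0 = 1"
  proof -
    have "degree (monom (1::'a) i) < degree (monom (1::'a) j)"
      using ij by (simp add: degree_monom_eq)
    hence "degree h0 = j"
      using degree_add_eq_left[of "- monom (1::'a) i" "monom 1 j"]
      by (simp add: h0_def degree_monom_eq)
    thus ?thesis using ij by (simp add: h0_def)
  qed
  moreover have "f dvd q_associate h0"
    using ij(2) by (simp add: h0_def q_associate_diff q_associate_monom mod_eq_dvd_iff[symmetric])
  ultimately have ex: "?P h0" by blast
  define h where "h = arg_min degree ?P"
  have h: "?P h" "\<And>y. ?P y \<Longrightarrow> degree h \<le> degree y"
    unfolding h_def using arg_min_nat_lemma[of ?P h0 degree] ex by auto
  show ?thesis
  proof (rule ex1I)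
    show "is_Fq_Order f h"
      using h by (force simp: is_Fq_Order_def is_arg_min_def)
  next
    fix g assume "is_Fq_Order f g"
    hence g: "?P g" "\<And>y. ?P y \<Longrightarrow> degree g \<le> degree y"
      by (force simp: is_Fq_Order_def is_arg_min_def)+
    have deg: "degree g = degree h"
      using g h by (intro antisym) blast+
    show "g = h"
    proof (rule ccontr)
      assume "g \<noteq> h"
      define d where "d = g - h"
      have d: "d \<noteq> 0" "f dvd q_associate d"
        using \<open>g \<noteq> h\<close> g h by (auto simp: d_def q_associate_diff)
      have "coeff d (degree h) = 0" "degree d \<le> degree h"
        using g h deg by (auto simp: d_def intro: degree_diff_le)
      hence less: "degree d < degree h"
        using d(1) by (metis le_neq_implies_less leading_coeff_0_iff)
      have "?P (smult (inverse (lead_coeff d)) d)"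
        using d by (auto simp: q_associate_smult dvd_smult)
      hence "degree h \<le> degree (smult (inverse (lead_coeff d)) d)"
        by (rule h)
      thus False using less d by simp
    qed
  qed
qed

lemma is_Fq_Order_Fq_Order: "f \<noteq> 0 \<Longrightarrow> is_Fq_Order f (Fq_Order f)"
  unfolding Fq_Order_def by (rule theI') (rule ex1_Fq_Order)

lemma zero_in_ext_field: "0 \<in> ext_field m"
  by (simp add: ext_field_def)

lemma to_ac_in_ext_field: "to_ac c \<in> ext_field m"
  by (simp add: ext_field_def finite_field_power_card_power_eq_same flip: to_ac_power)

lemma mult_in_ext_field: "x \<in> ext_field m \<Longrightarrow> y \<in> ext_field m \<Longrightarrow> x * y \<in> ext_field m"
  by (simp add: ext_field_def power_mult_distrib)

lemma inverse_in_ext_field: "x \<in> ext_field m \<Longrightarrow> inverse x \<in> ext_field m"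
  by (simp add: ext_field_def power_inverse)

lemma add_power_card_power:
  fixes x y :: "'a::finite_field alg_closure"
  shows "(x + y) ^ (CARD('a) ^ m) = x ^ (CARD('a) ^ m) + y ^ (CARD('a) ^ m)"
proof (induction m arbitrary: x y)
  case (Suc m)
  let ?q = "CARD('a)"
  have q: "?q \<ge> 2"
    using card_mono[of "UNIV :: 'a set" "{0, 1}"] by simp
  have binom: "of_nat (?q choose k) = (0 :: 'a)" if k: "0 < k" "k < ?q" for k
  proof -
    define p where "p = (\<Sum>i\<in>{0<..<?q}. monom (of_nat (?q choose i) :: 'a) i)"
    have coeff_p: "coeff p i = (if 0 < i \<and> i < ?q then of_nat (?q choose i) else 0)" for i
      by (auto simp: p_def coeff_sum)
    have "degree p \<le> ?q - 1"
      by (rule degree_le) (auto simp: coeff_p)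
    hence deg: "degree p < ?q" using q by linarith
    have "poly p z = 0" for z
    proof -
      have "z + 1 = (z + 1) ^ ?q"
        by (simp add: finite_field_power_card_eq_same)
      also have "\<dots> = (\<Sum>i\<le>?q. of_nat (?q choose i) * z ^ i)"
        by (simp add: binomial_ring)
      also have "{..?q} = insert 0 (insert ?q {0<..<?q})"
        by auto
      also have "(\<Sum>i\<in>\<dots>. of_nat (?q choose i) * z ^ i) = 1 + (z ^ ?q + poly p z)"
        using q by (simp add: p_def poly_sum poly_monom)
      finally show ?thesis
        by (simp add: finite_field_power_card_eq_same)
    qed
    hence "p = 0"
      using card_poly_roots_bound[of p] deg by auto
    thus ?thesis using coeff_p[of k] k by simp
  qed
  have step: "(u + v) ^ ?q = u ^ ?q + v ^ ?q" for u v :: "'a alg_closure"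
  proof -
    have "(u + v) ^ ?q = (\<Sum>i\<le>?q. of_nat (?q choose i) * u ^ i * v ^ (?q - i))"
      by (rule binomial_ring)
    also have "\<dots> = (\<Sum>i\<in>{0, ?q}. of_nat (?q choose i) * u ^ i * v ^ (?q - i))"
    proof (intro sum.mono_neutral_right ballI)
      fix i assume "i \<in> {..?q} - {0, ?q}"
      hence "of_nat (?q choose i) = (0 :: 'a)"
        by (intro binom) auto
      hence "of_nat (?q choose i) = (0 :: 'a alg_closure)"
        by (metis to_ac_0 to_ac_of_nat)
      thus "of_nat (?q choose i) * u ^ i * v ^ (?q - i) = 0"
        by simp
    qed auto
    finally show ?thesis using q by (simp add: add_ac)
  qed
  show ?case
    by (simp add: power_mult step Suc.IH)
qed auto

lemma add_in_ext_field: "x \<in> ext_field m \<Longrightarrow> y \<in> ext_field m \<Longrightarrow> x + y \<in> ext_field m"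
  by (simp add: ext_field_def add_power_card_power)

lemma card_ext_field:
  assumes "m \<ge> 1"
  shows "card (ext_field m :: 'a::finite_field alg_closure set) = CARD('a) ^ m"
proof -
  let ?q = "CARD('a)"
  have q: "?q \<ge> 2"
    using card_mono[of "UNIV :: 'a set" "{0, 1}"] by simp
  define N where "N = ?q ^ m"
  have N: "N > 1"
    unfolding N_def using q assms by (intro one_less_power) auto
  define p :: "'a alg_closure poly" where "p = monom 1 N - monom 1 1"
  have roots: "ext_field m = {x. poly p x = 0}"
    by (auto simp: p_def ext_field_def poly_monom N_def)
  have deg: "degree p = N"
    using degree_add_eq_left[of "- monom (1::'a alg_closure) 1" "monom 1 N"] N
    by (simp add: p_def degree_monom_eq)
  hence "p \<noteq> 0" using N by auto
  have "of_nat ?q = (0 :: 'a)"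
  proof -
    have "(\<Sum>x\<in>UNIV. x) = (\<Sum>x\<in>UNIV. x + (1::'a))"
      by (rule sum.reindex_bij_witness[of _ "\<lambda>x. x + 1" "\<lambda>x. x - 1"]) auto
    thus ?thesis by (simp add: sum.distrib)
  qed
  hence "of_nat ?q = (0 :: 'a alg_closure)"
    by (metis to_ac_0 to_ac_of_nat)
  hence "of_nat N = (0 :: 'a alg_closure)"
    using assms by (simp add: N_def)
  hence "pderiv p = - 1"
    by (simp add: p_def pderiv_diff pderiv_monom)
  have order: "order x p = (if poly p x = 0 then 1 else 0)" for x
  proof -
    have "\<not> [:-x, 1:] ^ 2 dvd p"
    proof
      assume "[:-x, 1:] ^ 2 dvd p"
      then obtain r where "p = [:-x, 1:] * ([:-x, 1:] * r)"
        by (metis dvdE mult.assoc power2_eq_square)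
      hence "poly (pderiv p) x = 0"
        by (simp add: pderiv_mult del: mult_pCons_left)
      with \<open>pderiv p = - 1\<close> show False by simp
    qed
    hence "order x p < 2"
      using order_1[of x p] by (meson dvd_trans le_imp_power_dvd not_le)
    moreover have "order x p = 0 \<longleftrightarrow> poly p x \<noteq> 0"
      using \<open>p \<noteq> 0\<close> by (simp add: order_root)
    ultimately show ?thesis by auto
  qed
  obtain A where A: "size A = N" "p = smult (lead_coeff p) (\<Prod>x\<in>#A. [:-x, 1:])"
    using alg_closed_imp_factorization[OF \<open>p \<noteq> 0\<close>] deg by auto
  have "proots p = proots (\<Prod>x\<in>#A. [:-x, 1:])"
    using \<open>p \<noteq> 0\<close> by (subst A(2)) simp
  also have "\<dots> = A"
  proof (induction A)
    case (add y A)
    have "(\<Prod>x\<in>#A. [:-x, 1:]) \<noteq> 0"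
      by (simp add: prod_mset_zero_iff image_iff)
    thus ?case
      using add by (simp add: proots_mult del: mult_pCons_left)
  qed simp
  finally have "size (proots p) = N" using A by simp
  moreover have "size (proots p) = card {x. poly p x = 0}"
    using \<open>p \<noteq> 0\<close> by (simp add: size_multiset_overloaded_eq order)
  ultimately show ?thesis by (simp add: roots N_def)
qed

end

theory Submission
  imports Defs
begin

text \<open>
  Every associate of degree less than \<open>m\<close> is evaluated at \<open>\<alpha>\<close> to an \<open>F\<^sub>q\<close>-combination of the
  conjugates of \<open>\<alpha>\<close>, so an element of \<open>F\<^bsub>q^m\<^esub>\<close> is normal iff no nonzero \<open>h\<close> of degree less than
  \<open>m\<close> satisfies \<open>(h \<circ> x)(\<alpha>) = 0\<close>; and \<open>\<alpha> \<in> F\<^bsub>q^m\<^esub>\<close> says that \<open>x\<^sup>m - 1\<close> does satisfy this. When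
  \<open>f\<close> is the minimal polynomial of \<open>\<alpha>\<close>, the condition at \<open>\<alpha>\<close> is divisibility by \<open>f\<close>.
  What remains is that a polynomial of degree \<open>m\<close> and order \<open>x\<^sup>m - 1\<close> is irreducible: its Berlekamp
  subalgebra, the Frobenius-fixed part of \<open>F\<^sub>q[x]/(f)\<close>, is one-dimensional.
\<close>

section \<open>Frobenius on polynomials and associates\<close>

lemma map_poly_to_ac_diff:
  "map_poly to_ac (p - r) = map_poly to_ac p - map_poly to_ac r"
  by (rule poly_eqI) (simp add: coeff_map_poly)

lemma map_poly_to_ac_add:
  "map_poly to_ac (p + r) = map_poly to_ac p + map_poly to_ac r"
  by (rule poly_eqI) (simp add: coeff_map_poly)

lemma map_poly_to_ac_smult:
  "map_poly to_ac (smult c p) = smult (to_ac c) (map_poly to_ac p)"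
  by (rule poly_eqI) (simp add: coeff_map_poly)

lemma map_poly_to_ac_mult:
  "map_poly to_ac (p * r) = map_poly to_ac p * map_poly to_ac r"
  by (rule poly_eqI) (simp add: coeff_map_poly coeff_mult to_ac_sum)

lemma map_poly_to_ac_power:
  "map_poly to_ac (p ^ n) = map_poly to_ac p ^ n"
  by (induction n) (simp_all add: map_poly_to_ac_mult)

lemma card_finite_field_ge_2: "CARD('a::finite_field) \<ge> 2"
  using card_mono[of "UNIV :: 'a set" "{0, 1}"] by simp

text \<open>If the closure had \<open>N\<close> elements, its subset \<open>ext_field N\<close>,
  with \<open>q ^ N > N\<close> elements, would not fit.\<close>

lemma infinite_alg_closure: "infinite (UNIV :: 'a::finite_field alg_closure set)"
proof
  let ?q = "CARD('a)"
  assume fin: "finite (UNIV :: 'a alg_closure set)"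
  define N where "N = CARD('a alg_closure)"
  have "N < ?q ^ N"
    using card_finite_field_ge_2[where 'a = 'a]
    by (metis less_exp less_le_trans power_mono zero_le)
  moreover have "N \<ge> 1"
    using fin by (simp add: N_def Suc_leI finite_UNIV_card_ge_0)
  hence "card (ext_field N :: 'a alg_closure set) = ?q ^ N"
    by (rule card_ext_field)
  ultimately show False
    using card_mono[OF fin subset_UNIV, of "ext_field N"] by (simp add: N_def)
qed

text \<open>Both sides agree at every point of the infinite algebraic closure.\<close>

lemma poly_add_power_card_power:
  fixes p r :: "'a::finite_field poly"
  shows "(p + r) ^ (CARD('a) ^ n) = p ^ (CARD('a) ^ n) + r ^ (CARD('a) ^ n)"
proof -
  let ?N = "CARD('a) ^ n"
  let ?d = "(p + r) ^ ?N - (p ^ ?N + r ^ ?N)"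
  have "poly (map_poly to_ac ?d) z = 0" for z
    by (simp add: map_poly_to_ac_diff map_poly_to_ac_add map_poly_to_ac_power
        add_power_card_power)
  hence "map_poly to_ac ?d = 0"
    using poly_roots_finite[of "map_poly to_ac ?d"] infinite_alg_closure by fastforce
  hence "?d = 0"
    by (subst (asm) map_poly_eq_0_iff) auto
  thus ?thesis by simp
qed

lemmas poly_add_power_card = poly_add_power_card_power[of _ _ 1, simplified]

lemma poly_diff_power_card:
  fixes p r :: "'a::finite_field poly"
  shows "(p - r) ^ CARD('a) = p ^ CARD('a) - r ^ CARD('a)"
  using poly_add_power_card[of "p - r" r] by simp

lemma poly_sum_power_card:
  fixes F :: "'b \<Rightarrow> 'a::finite_field poly"
  shows "(\<Sum>i\<in>A. F i) ^ CARD('a) = (\<Sum>i\<in>A. F i ^ CARD('a))"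
proof (induction A rule: infinite_finite_induct)
  case (insert x A)
  thus ?case by (simp add: poly_add_power_card)
qed (use card_finite_field_ge_2[where 'a = 'a] in \<open>simp_all add: power_0_left\<close>)

lemma q_associate_add:
  fixes g h :: "'a::finite_field poly"
  shows "q_associate (g + h) = q_associate g + q_associate h"
  using q_associate_diff[of "g + h" h] by (simp add: algebra_simps)

text \<open>Frobenius is additive and fixes the coefficients, so multiplication by x on
  \<open>h\<close> turns into Frobenius on the associate.\<close>

lemma q_associate_shift:
  fixes h :: "'a::finite_field poly"
  shows "q_associate (pCons 0 h) = q_associate h ^ CARD('a)"
proof -
  have "q_associate (pCons 0 h) =
      (\<Sum>i\<le>Suc (degree h). monom (coeff (pCons 0 h) i) (CARD('a) ^ i))"
    by (rule q_associate_altdef) (rule degree_pCons_le)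
  also have "\<dots> = (\<Sum>i\<le>degree h. monom (coeff h i) (CARD('a) ^ Suc i))"
    by (subst sum.atMost_Suc_shift) simp
  also have "\<dots> = (\<Sum>i\<le>degree h. monom (coeff h i) (CARD('a) ^ i) ^ CARD('a))"
    by (simp add: monom_power finite_field_power_card_eq_same mult.commute)
  finally show ?thesis
    by (simp add: q_associate_def poly_sum_power_card)
qed

lemma degree_monom_minus_1:
  assumes "n \<ge> 1"
  shows "degree (monom 1 n - 1 :: 'a::field poly) = n"
proof -
  have "degree (monom 1 n + (- 1) :: 'a poly) = degree (monom (1::'a) n)"
    using assms by (intro degree_add_eq_left) (simp add: degree_monom_eq)
  thus ?thesis by (simp add: degree_monom_eq)
qed

lemma q_associate_monom_minus_1:
  "q_associate (monom 1 n - 1 :: 'a::finite_field poly) = monom 1 (CARD('a) ^ n) - monom 1 1"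
  using q_associate_diff[of "monom (1::'a) n" "monom 1 0"]
    q_associate_monom[of "1::'a" 0] q_associate_monom[of "1::'a" n]
  by (simp add: monom_0 one_pCons)

text \<open>The hypothesis says that the \<open>n\<close>-fold Frobenius fixes the class of x modulo
  \<open>f\<close>. It also fixes constants, hence everything they generate; the induction is
  Horner's scheme.\<close>

lemma dvd_frobenius_power_diff:
  fixes f u :: "'a::finite_field poly"
  assumes "f dvd monom 1 (CARD('a) ^ n) - monom 1 1"
  shows "f dvd u ^ (CARD('a) ^ n) - u"
proof (induction u)
  case 0
  show ?case by (simp add: power_0_left)
next
  case (pCons a u)
  let ?N = "CARD('a) ^ n" and ?X = "monom (1::'a) 1"
  have split: "pCons a u = [:a:] + ?X * u"
    by (simp add: monom_altdef)
  have "[:a:] ^ ?N = [:a:]"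
    by (simp add: poly_const_pow finite_field_power_card_power_eq_same)
  hence "pCons a u ^ ?N - pCons a u = ?X ^ ?N * u ^ ?N - ?X * u"
    unfolding split by (simp add: poly_add_power_card_power power_mult_distrib)
  also have "\<dots> = (?X ^ ?N - ?X) * u ^ ?N + ?X * (u ^ ?N - u)"
    by (simp add: algebra_simps)
  also have "f dvd \<dots>"
    using assms pCons.IH by (intro dvd_add dvd_mult dvd_mult2) (simp_all add: monom_power)
  finally show ?case .
qed


section \<open>Polynomials of maximal order are irreducible\<close>

lemma is_Fq_OrderD:
  assumes "is_Fq_Order f r"
  shows "lead_coeff r = 1" "f dvd q_associate r"
    and "\<And>h. lead_coeff h = 1 \<Longrightarrow> f dvd q_associate h \<Longrightarrow> degree r \<le> degree h"
  using assms by (force simp: is_Fq_Order_def is_arg_min_def)+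

text \<open>Dividing a nonzero \<open>h\<close> by its leading coefficient would give a monic
  competitor of smaller degree.\<close>

lemma is_Fq_Order_eq_0:
  assumes "is_Fq_Order f r" "f dvd q_associate h" "degree h < degree r"
  shows "h = 0"
proof (rule ccontr)
  assume "h \<noteq> 0"
  hence "degree r \<le> degree (smult (inverse (lead_coeff h)) h)"
    using assms(2) by (intro is_Fq_OrderD[OF assms(1)]) (auto simp: q_associate_smult dvd_smult)
  thus False using assms(3) \<open>h \<noteq> 0\<close> by simp
qed

text \<open>Used as injectivity of multiplication by x - 1.\<close>

lemma pCons_0_eq_self: "pCons 0 h = h \<Longrightarrow> h = 0"
  by (metis degree_pCons_eq n_not_Suc_n)

text \<open>The Berlekamp subalgebra of \<open>f\<close> consists of the constants: modulo \<open>f\<close>, every residue is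
  an associate \<open>h \<circ> x\<close>, and if it is fixed by Frobenius then \<open>x\<^sup>m - 1\<close> divides \<open>(x - 1) h\<close>,
  so that \<open>h\<close> lies on a line.\<close>

lemma frobenius_fixed_imp_const:
  fixes f u :: "'a::finite_field poly"
  assumes m: "degree f = m" "m \<ge> 1" and ord: "is_Fq_Order f (monom 1 m - 1)"
    and u: "f dvd u ^ CARD('a) - u"
  shows "\<exists>c. f dvd u - [:c:]"
proof -
  let ?S = "{h :: 'a poly. degree h < m}" and ?q = "CARD('a)"
  have deg: "degree (monom 1 m - 1 :: 'a poly) = m"
    using m by (simp add: degree_monom_minus_1)
  have zero: "h = 0" if "f dvd q_associate h" "degree h < m" for h
    using is_Fq_Order_eq_0[OF ord that(1)] that(2) deg by simp
  have mod_less: "degree (v mod f) < m" for v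
    using m degree_mod_less[of f v] by (cases "f = 0"; cases "v mod f = 0") simp_all
  \<comment> \<open>Maximality of the order gives injectivity, and an injective self-map of the
    finite set \<open>?S\<close> is onto.\<close>
  have img: "(\<lambda>h. q_associate h mod f) ` ?S = ?S"
  proof (rule endo_inj_surj[OF finite_degree_less])
    show "(\<lambda>h. q_associate h mod f) ` ?S \<subseteq> ?S"
      by (rule image_subsetI, rule CollectI, rule mod_less)
    show "inj_on (\<lambda>h. q_associate h mod f) ?S"
    proof (rule inj_onI)
      fix g h assume gh: "g \<in> ?S" "h \<in> ?S" "q_associate g mod f = q_associate h mod f"
      have "g - h = 0"
      proof (rule zero)
        show "f dvd q_associate (g - h)"
          using gh(3) by (simp only: q_associate_diff mod_eq_dvd_iff)
        show "degree (g - h) < m"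
          using gh by (simp add: degree_diff_less)
      qed
      thus "g = h" by simp
    qed
  qed
  have surj: "\<exists>h. degree h < m \<and> f dvd q_associate h - v" for v
  proof -
    have "v mod f \<in> ?S"
      by (simp add: mod_less)
    hence "v mod f \<in> (\<lambda>h. q_associate h mod f) ` ?S"
      by (simp only: img)
    then obtain h where "h \<in> ?S" "v mod f = q_associate h mod f"
      by (rule imageE)
    hence "degree h < m" "q_associate h mod f = v mod f"
      by simp_all
    thus ?thesis by (metis mod_eq_dvd_iff)
  qed
  have line: "\<exists>h c. f dvd q_associate h - v \<and> pCons 0 h - h = smult c (monom 1 m - 1)"
    if v: "f dvd v ^ ?q - v" for v
  proof -
    obtain h where h: "degree h < m" "f dvd q_associate h - v"
      using surj by blast
    \<comment> \<open>This is the coefficient of x^m in (x - 1) h, so subtracting c (x^m - 1) brings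
      the degree below \<open>m\<close>.\<close>
    define c where "c = coeff h (m - 1)"
    define d where "d = pCons 0 h - h - smult c (monom 1 m - 1)"
    have "q_associate (pCons 0 h - h) =
        (q_associate h - v) ^ ?q - (q_associate h - v) + (v ^ ?q - v)"
      by (simp add: q_associate_diff q_associate_shift poly_diff_power_card)
    also have "f dvd \<dots>"
      using dvd_trans[OF h(2) dvd_power[of "?q"]] by (intro dvd_add dvd_diff h v) simp_all
    finally have "f dvd q_associate (pCons 0 h - h)" .
    hence "f dvd q_associate (pCons 0 h - h) - smult c (q_associate (monom 1 m - 1))"
      by (intro dvd_diff dvd_smult is_Fq_OrderD(2)[OF ord])
    hence "f dvd q_associate d"
      unfolding d_def by (simp only: q_associate_diff[of "pCons 0 h - h"] q_associate_smult)
    moreover have "degree d < m"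
    proof -
      have "coeff d i = 0" if "i \<ge> m" for i
        using that h(1) m(2)
        by (cases "i = m")
          (auto simp: d_def c_def coeff_pCons coeff_eq_0 coeff_1 split: nat.splits)
      hence "degree d \<le> m - 1"
        by (intro degree_le) auto
      thus ?thesis using m by simp
    qed
    ultimately have "d = 0" by (rule zero)
    thus ?thesis using h by (auto simp: d_def)
  qed
  obtain h c where h: "f dvd q_associate h - u" "pCons 0 h - h = smult c (monom 1 m - 1)"
    using line[OF u] by blast
  \<comment> \<open>The constant 1 is Frobenius-fixed too; its preimage \<open>h1\<close> serves as
    generator of the line.\<close>
  obtain h1 c1 where h1: "f dvd q_associate h1 - 1" "pCons 0 h1 - h1 = smult c1 (monom 1 m - 1)"
    using line[of 1] by auto
  have "c1 \<noteq> 0"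
  proof
    assume "c1 = 0"
    hence "h1 = 0" using h1(2) by (intro pCons_0_eq_self) simp
    hence "f dvd 1" using h1(1) by (simp add: q_associate_def)
    thus False using m by (metis is_unit_iff_degree not_one_le_zero dvd_0_left zero_neq_one)
  qed
  \<comment> \<open>With this ratio (x - 1)(h - e h1) vanishes, so \<open>u\<close> is congruent to
    \<open>e\<close> times 1.\<close>
  define e where "e = c / c1"
  have "pCons 0 (h - smult e h1) - (h - smult e h1) =
      (pCons 0 h - h) - smult e (pCons 0 h1 - h1)"
    by (rule poly_eqI) (simp add: coeff_pCons algebra_simps split: nat.splits)
  also have "\<dots> = 0"
    using \<open>c1 \<noteq> 0\<close> by (simp add: h(2) h1(2) e_def)
  finally have "h = smult e h1"
    using pCons_0_eq_self[of "h - smult e h1"] by simp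
  hence "u - [:e:] = smult e (q_associate h1 - 1) - (q_associate h - u)"
    by (simp add: q_associate_smult smult_diff_right one_pCons)
  also have "f dvd \<dots>"
    by (rule dvd_diff[OF dvd_smult[OF h1(1)] h(1)])
  finally show ?thesis by blast
qed

text \<open>For \<open>f = g k\<close> the power \<open>g\<^bsup>q\<^sup>m - 1\<^esup>\<close> is idempotent, hence constant modulo \<open>f\<close>, and the
  constant is \<open>0\<close> since \<open>g\<close> divides it.\<close>

lemma Fq_Order_maximal_imp_dvd_factor:
  fixes f g :: "'a::finite_field poly"
  assumes m: "degree f = m" "m \<ge> 1" and ord: "is_Fq_Order f (monom 1 m - 1)"
    and g: "g dvd f" "degree g > 0"
  shows "f dvd g"
proof -
  let ?N = "CARD('a) ^ m"
  have N: "?N \<ge> 2"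
    using card_finite_field_ge_2[where 'a = 'a] m(2)
      self_le_power[of "CARD('a)" m] by simp
  define e where "e = g ^ (?N - 1)"
  have ge: "g * e = g ^ ?N"
    unfolding e_def using N by (simp flip: power_Suc)
  have frob: "f dvd g * e - g"
    unfolding ge using is_Fq_OrderD(2)[OF ord]
    by (intro dvd_frobenius_power_diff) (simp add: q_associate_monom_minus_1)
  \<comment> \<open>One factor \<open>e\<close> is split as \<open>g * g ^ (?N - 2)\<close>, which
    exposes the multiple \<open>g * e - g\<close> of \<open>f\<close>.\<close>
  have "e * e - e = (g * e - g) * g ^ (?N - 2)"
  proof -
    have "e = g * g ^ (?N - 2)"
      unfolding e_def using N by (simp flip: power_Suc add: Suc_diff_Suc numeral_2_eq_2)
    thus ?thesis by (simp add: algebra_simps)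
  qed
  hence idem: "f dvd e * e - e"
    using frob by simp
  have "f dvd e ^ Suc n - e" for n
  proof (induction n)
    case (Suc n)
    have "e ^ Suc (Suc n) - e = e * (e ^ Suc n - e) + (e * e - e)"
      by (simp add: algebra_simps)
    thus ?case using Suc idem by (metis dvd_add dvd_mult)
  qed simp
  hence "f dvd e ^ CARD('a) - e"
    by (metis Suc_pred zero_less_card_finite)
  then obtain c where c: "f dvd e - [:c:]"
    using frobenius_fixed_imp_const[OF m ord] by blast
  have "g dvd e"
    unfolding e_def using N by (intro dvd_power) auto
  hence "g dvd [:c:]"
    using dvd_trans[OF g(1) c] by (simp add: dvd_diff_right_iff)
  hence "c = 0"
    using g(2) dvd_imp_degree_le[of g "[:c:]"] by fastforce
  hence ge0: "f dvd g * e"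
    using c by (simp add: dvd_mult)
  show ?thesis
    using dvd_diff[OF ge0 frob] by simp
qed


section \<open>Minimal polynomials and normal elements\<close>

text \<open>The remainder of \<open>g\<close> modulo \<open>p\<close> vanishes at \<alpha> along
  with \<open>g\<close>; were it nonzero, its monic multiple would contradict minimality.\<close>

lemma min_poly_dvd_iff:
  assumes "is_min_poly \<alpha> p"
  shows "p dvd g \<longleftrightarrow> poly (map_poly to_ac g) \<alpha> = 0"
proof
  have p: "lead_coeff p = 1" "poly (map_poly to_ac p) \<alpha> = 0"
    and le: "\<And>y. lead_coeff y = 1 \<Longrightarrow> poly (map_poly to_ac y) \<alpha> = 0 \<Longrightarrow> degree p \<le> degree y"
    using assms by (force simp: is_min_poly_def is_arg_min_def)+
  show "poly (map_poly to_ac g) \<alpha> = 0" if "p dvd g"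
    using that p by (auto elim!: dvdE simp: map_poly_to_ac_mult)
  assume g: "poly (map_poly to_ac g) \<alpha> = 0"
  define r where "r = g mod p"
  have "r = g - p * (g div p)"
    by (simp add: r_def minus_mult_div_eq_mod)
  hence r: "poly (map_poly to_ac r) \<alpha> = 0"
    using g p by (simp add: map_poly_to_ac_diff map_poly_to_ac_mult)
  have "r = 0"
  proof (rule ccontr)
    assume "r \<noteq> 0"
    hence "degree p \<le> degree (smult (inverse (lead_coeff r)) r)"
      using r by (intro le) (simp_all add: map_poly_to_ac_smult)
    moreover have "degree r < degree p"
      using \<open>r \<noteq> 0\<close> degree_mod_less[of p g] p(1) by (force simp: r_def)
    ultimately show False using \<open>r \<noteq> 0\<close> by simp
  qed
  thus "p dvd g" by (simp add: r_def dvd_eq_mod_eq_0)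
qed

lemma ex_min_poly:
  assumes "g \<noteq> 0" "poly (map_poly to_ac g) \<alpha> = 0"
  shows "\<exists>p. is_min_poly \<alpha> p"
proof -
  let ?P = "\<lambda>g. lead_coeff g = 1 \<and> poly (map_poly to_ac g) \<alpha> = 0"
  have "?P (smult (inverse (lead_coeff g)) g)"
    using assms by (simp add: map_poly_to_ac_smult)
  thus ?thesis
    unfolding is_min_poly_def is_arg_min_linorder by (rule ex_has_least_nat)
qed

section \<open>Counting polynomials and evaluating associates at a point\<close>

lemma card_degree_less:
  assumes "m \<ge> 1"
  shows "card {h :: 'a::{finite,zero} poly. degree h < m} = CARD('a) ^ m"
proof -
  have "bij_betw (\<lambda>h. map (coeff h) [0..<m]) {h :: 'a poly. degree h < m}
      {xs. set xs \<subseteq> UNIV \<and> length xs = m}"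
  proof (rule bij_betw_byWitness[where f' = Poly])
    show "\<forall>h\<in>{h :: 'a poly. degree h < m}. Poly (map (coeff h) [0..<m]) = h"
      by (auto intro!: poly_eqI simp: nth_default_def coeff_eq_0)
    show "\<forall>xs\<in>{xs :: 'a list. set xs \<subseteq> UNIV \<and> length xs = m}. map (coeff (Poly xs)) [0..<m] = xs"
      by (auto intro!: nth_equalityI simp: nth_default_def)
    show "Poly ` {xs :: 'a list. set xs \<subseteq> UNIV \<and> length xs = m} \<subseteq> {h. degree h < m}"
    proof safe
      fix xs :: "'a list"
      assume "m = length xs"
      have "degree (Poly xs) \<le> length xs - 1"
        by (intro degree_le) (auto simp: nth_default_def)
      thus "degree (Poly xs) < length xs"
        using assms \<open>m = length xs\<close> by linarith
    qed
  qed auto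
  thus ?thesis
    using card_lists_length_eq[of "UNIV :: 'a set" m] by (simp add: bij_betw_same_card)
qed

lemma poly_q_associate:
  fixes h :: "'a::finite_field poly"
  assumes "degree h < m"
  shows "poly (map_poly to_ac (q_associate h)) \<alpha> =
    (\<Sum>i<m. ac_scale (coeff h i) (\<alpha> ^ (CARD('a) ^ i)))"
proof -
  have "map_poly to_ac (\<Sum>i\<in>A. F i) = (\<Sum>i\<in>A. map_poly to_ac (F i))"
    for A :: "nat set" and F :: "nat \<Rightarrow> 'a poly"
    by (induction A rule: infinite_finite_induct) (simp_all add: map_poly_to_ac_add)
  moreover have "{..m - 1} = {..<m}"
    using assms by auto
  ultimately show ?thesis
    using assms q_associate_altdef[of h "m - 1"]
    by (simp add: map_poly_monom poly_sum poly_monom ac_scale_def)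
qed

lemma power_in_ext_field: "x \<in> ext_field m \<Longrightarrow> x ^ n \<in> ext_field m"
  for x :: "'a::finite_field alg_closure"
  using power_mult[of x n "CARD('a) ^ m"] power_mult[of x "CARD('a) ^ m" n]
  by (simp add: ext_field_def mult.commute)

lemma subspace_ext_field: "ac.subspace (ext_field m :: 'a::finite_field alg_closure set)"
  by (rule ac.subspaceI)
    (auto simp: ac_scale_def zero_in_ext_field add_in_ext_field mult_in_ext_field to_ac_in_ext_field)

text \<open>Both spaces have \<open>q\<^sup>m\<close> elements, so the conjugates span \<open>ext_field m\<close> iff the
  evaluation \<open>h \<mapsto> (h \<circ> x)(\<alpha>)\<close> is injective in degrees less than \<open>m\<close>.\<close>

lemma normal_element_iff:
  fixes \<alpha> :: "'a::finite_field alg_closure"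
  assumes m: "m \<ge> 1"
  shows "normal_element m \<alpha> \<longleftrightarrow> \<alpha> \<in> ext_field m \<and>
    (\<forall>h. degree h < m \<longrightarrow> poly (map_poly to_ac (q_associate h)) \<alpha> = 0 \<longrightarrow> h = 0)"
    (is "_ \<longleftrightarrow> _ \<and> ?ker")
proof (cases "\<alpha> \<in> ext_field m")
  case False
  thus ?thesis by (simp add: normal_element_def)
next
  case True
  let ?E = "ext_field m :: 'a alg_closure set"
  define S where "S = {h :: 'a poly. degree h < m}"
  define \<Phi> where "\<Phi> = (\<lambda>h. poly (map_poly to_ac (q_associate h)) \<alpha>)"
  define b where "b = (\<lambda>i. \<alpha> ^ (CARD('a) ^ i))"
  define B where "B = b ` {..<m}"
  have \<Phi>: "\<Phi> h = (\<Sum>i<m. ac_scale (coeff h i) (b i))" if "h \<in> S" for h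
    using that by (simp add: S_def \<Phi>_def b_def poly_q_associate)
  have \<Phi>_monom: "\<Phi> (monom 1 i) = b i" for i
    by (simp add: \<Phi>_def b_def q_associate_monom map_poly_monom poly_monom)
  have \<Phi>_diff: "\<Phi> (g - h) = \<Phi> g - \<Phi> h" for g h
    by (simp add: \<Phi>_def q_associate_diff map_poly_to_ac_diff)
  have monom_S: "monom c i \<in> S" if "i < m" for c i
    using that le_less_trans[OF degree_monom_le] by (auto simp: S_def)
  have diff_S: "g - h \<in> S" if "g \<in> S" "h \<in> S" for g h
    using that by (auto simp: S_def intro: degree_diff_less)
  \<comment> \<open>These equal counts let injectivity of \<Phi> on \<open>S\<close> be read as
    surjectivity onto \<open>?E\<close>.\<close>
  have finS: "finite S" and cardS: "card S = card ?E"
    using m by (simp_all add: S_def finite_degree_less card_degree_less card_ext_field)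
  have B_sub: "B \<subseteq> ?E"
    using True by (auto simp: B_def b_def power_in_ext_field)
  hence span_sub: "ac.span B \<subseteq> ?E"
    by (intro ac.span_minimal subspace_ext_field)
  have img_sub: "\<Phi> ` S \<subseteq> ac.span B"
    unfolding B_def
    by (auto simp: \<Phi> intro!: ac.span_sum ac.span_scale intro: ac.span_base)
  \<comment> \<open>The image is a subspace containing \<open>B\<close>, so it is all of the
    span.\<close>
  have "ac.subspace (\<Phi> ` S)"
  proof (rule ac.subspaceI)
    have "0 \<in> S" "\<Phi> 0 = 0"
      using m by (simp_all add: S_def \<Phi>_def q_associate_def)
    thus "0 \<in> \<Phi> ` S" by (metis imageI)
  next
    fix x y assume "x \<in> \<Phi> ` S" "y \<in> \<Phi> ` S"
    then obtain g h where "g \<in> S" "h \<in> S" "x = \<Phi> g" "y = \<Phi> h"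
      by auto
    moreover from this have "g + h \<in> S" "\<Phi> (g + h) = \<Phi> g + \<Phi> h"
      by (auto simp: S_def \<Phi>_def q_associate_add map_poly_to_ac_add intro: degree_add_less)
    ultimately show "x + y \<in> \<Phi> ` S" by (metis imageI)
  next
    fix c x assume "x \<in> \<Phi> ` S"
    then obtain h where "h \<in> S" "x = \<Phi> h"
      by auto
    moreover from this have "smult c h \<in> S" "\<Phi> (smult c h) = ac_scale c (\<Phi> h)"
      using le_less_trans[OF degree_smult_le]
      by (auto simp: S_def \<Phi>_def q_associate_smult map_poly_to_ac_smult ac_scale_def)
    ultimately show "ac_scale c x \<in> \<Phi> ` S" by (metis imageI)
  qed
  moreover have "B \<subseteq> \<Phi> ` S"
    unfolding B_def using monom_S \<Phi>_monom by (metis image_eqI image_subsetI lessThan_iff)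
  ultimately have "ac.span B = \<Phi> ` S"
    using img_sub by (intro antisym ac.span_minimal)
  have finE: "finite ?E"
    by (rule card_ge_0_finite) (simp add: card_ext_field[OF m])
  have inj_iff: "inj_on \<Phi> S \<longleftrightarrow> ac.span B = ?E"
    using card_image[of \<Phi> S] eq_card_imp_inj_on[OF finS, of \<Phi>] finE cardS span_sub
      \<open>ac.span B = \<Phi> ` S\<close> card_subset_eq[of ?E "ac.span B"] by auto
  have ker_iff: "inj_on \<Phi> S \<longleftrightarrow> ?ker"
  proof
    assume "inj_on \<Phi> S"
    moreover have "0 \<in> S" "\<Phi> 0 = 0"
      using m by (simp_all add: S_def \<Phi>_def q_associate_def)
    ultimately show ?ker
      unfolding inj_on_def S_def \<Phi>_def by fastforce
  next
    assume ?ker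
    show "inj_on \<Phi> S"
    proof (rule inj_onI)
      fix g h assume "g \<in> S" "h \<in> S" "\<Phi> g = \<Phi> h"
      hence "g - h \<in> S" "\<Phi> (g - h) = 0"
        by (simp_all add: diff_S \<Phi>_diff)
      with \<open>?ker\<close> have "g - h = 0"
        unfolding S_def \<Phi>_def by blast
      thus "g = h" by simp
    qed
  qed
  \<comment> \<open>Spanning already forces injectivity, so independence comes for free once
    \<open>B\<close> spans.\<close>
  have "ac.independent B" if inj: "inj_on \<Phi> S"
  proof -
    \<comment> \<open>\<open>B\<close> is a set, so a relation over \<open>B\<close> can be
      reindexed by exponents only when the conjugates are distinct.\<close>
    have inj_b: "inj_on b {..<m}"
    proof (rule inj_onI)
      fix i j assume "i \<in> {..<m}" "j \<in> {..<m}" "b i = b j"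
      hence "monom (1::'a) i = monom 1 j"
        using inj_onD[OF inj] monom_S by (metis \<Phi>_monom lessThan_iff)
      thus "i = j" by (metis degree_monom_eq one_neq_zero)
    qed
    have "u v = 0" if u: "(\<Sum>v\<in>B. ac_scale (u v) v) = 0" and v: "v \<in> B" for u v
    proof -
      \<comment> \<open>The linear relation \<open>u\<close> is encoded as a polynomial in the
        kernel of \<Phi>.\<close>
      define h where "h = (\<Sum>i<m. monom (u (b i)) i)"
      have coeff_h: "coeff h i = (if i < m then u (b i) else 0)" for i
        by (simp add: h_def coeff_sum)
      have "degree h \<le> m - 1"
        by (intro degree_le) (auto simp: coeff_h)
      hence "h \<in> S" using m by (simp add: S_def)
      have "\<Phi> h = (\<Sum>i<m. ac_scale (u (b i)) (b i))"
        by (simp add: \<Phi>[OF \<open>h \<in> S\<close>] coeff_h)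
      also have "\<dots> = 0"
        using u by (simp add: B_def sum.reindex[OF inj_b])
      finally have "h = 0"
        using ker_iff inj \<open>h \<in> S\<close> by (simp add: S_def \<Phi>_def)
      hence "u (b i) = 0" if "i < m" for i
        using coeff_h[of i] that by simp
      thus ?thesis using v by (auto simp: B_def)
    qed
    moreover have "finite B" by (simp add: B_def)
    ultimately show ?thesis by (auto simp: ac.dependent_finite)
  qed
  thus ?thesis
    using True inj_iff ker_iff unfolding normal_element_def Let_def B_def b_def by blast
qed

theorem proposition10:
  fixes f :: "'a::finite_field poly" and m :: nat
  assumes "degree f = m" and "m \<ge> 1"
  shows "normal_poly f \<longleftrightarrow> lead_coeff f = 1 \<and> Fq_Order f = monom 1 m - 1"
proof -
  have "f \<noteq> 0" using assms by auto
  have deg: "degree (monom 1 m - 1 :: 'a poly) = m"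
    using assms by (simp add: degree_monom_minus_1)
  have frob: "poly (map_poly to_ac (q_associate (monom (1::'a) m - 1))) \<alpha> = 0
      \<longleftrightarrow> \<alpha> \<in> ext_field m" for \<alpha>
    by (simp add: q_associate_monom_minus_1 map_poly_to_ac_diff map_poly_monom poly_monom
        ext_field_def)
  show ?thesis
  proof
    assume "normal_poly f"
    then obtain \<alpha> where norm: "normal_element m \<alpha>" and min: "is_min_poly \<alpha> f"
      using assms by (auto simp: normal_poly_def)
    note normal = norm[unfolded normal_element_iff[OF assms(2)]]
    have "is_Fq_Order f (monom 1 m - 1)"
      unfolding is_Fq_Order_def is_arg_min_def
    proof (intro conjI notI)
      show "lead_coeff (monom 1 m - 1 :: 'a poly) = 1"
        using assms by (simp add: deg)
      show "f dvd q_associate (monom 1 m - 1)"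
        using normal by (simp add: min_poly_dvd_iff[OF min] frob)
      assume "\<exists>h. (lead_coeff h = 1 \<and> f dvd q_associate h) \<and> degree h < degree (monom (1::'a) m - 1)"
      then obtain h where "lead_coeff h = 1" "f dvd q_associate h" "degree h < m"
        by (auto simp: deg)
      moreover from this have "h = 0"
        using normal by (simp add: min_poly_dvd_iff[OF min])
      ultimately show False by simp
    qed
    hence "Fq_Order f = monom 1 m - 1"
      using ex1_Fq_Order[OF \<open>f \<noteq> 0\<close>] is_Fq_Order_Fq_Order[OF \<open>f \<noteq> 0\<close>] by blast
    moreover have "lead_coeff f = 1"
      using min by (simp add: is_min_poly_def is_arg_min_def)
    ultimately show "lead_coeff f = 1 \<and> Fq_Order f = monom 1 m - 1"
      by blast
  next
    assume *: "lead_coeff f = 1 \<and> Fq_Order f = monom 1 m - 1"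
    hence ord: "is_Fq_Order f (monom 1 m - 1)"
      using is_Fq_Order_Fq_Order[OF \<open>f \<noteq> 0\<close>] by simp
    have "degree (map_poly to_ac f) > 0"
      using assms by (subst degree_map_poly) auto
    then obtain \<alpha> where \<alpha>: "poly (map_poly to_ac f) \<alpha> = 0"
      using alg_closed_imp_poly_has_root by blast
    \<comment> \<open>Any root \<alpha> will do: \<open>p\<close> is a nonconstant factor of
      \<open>f\<close>, so maximality of the order makes \<open>f\<close> divide \<open>p\<close>,
      and monic polynomials dividing each other coincide.\<close>
    obtain p where p: "is_min_poly \<alpha> p"
      using ex_min_poly[OF \<open>f \<noteq> 0\<close> \<alpha>] by blast
    have monic: "lead_coeff p = 1" and "poly (map_poly to_ac p) \<alpha> = 0"
      using p by (simp_all add: is_min_poly_def is_arg_min_def)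
    have "degree p > 0"
    proof (rule ccontr)
      assume "\<not> degree p > 0"
      hence "p = 1" using monic by (auto elim!: degree_eq_zeroE simp: one_pCons)
      thus False using \<open>poly (map_poly to_ac p) \<alpha> = 0\<close> by simp
    qed
    moreover have "p dvd f"
      using \<alpha> min_poly_dvd_iff[OF p] by blast
    ultimately have "f dvd p"
      using Fq_Order_maximal_imp_dvd_factor[OF assms ord] by blast
    then obtain k where k: "p = f * k" ..
    have deg_eq: "degree f = degree p"
      using \<open>p dvd f\<close> \<open>f dvd p\<close> \<open>f \<noteq> 0\<close> \<open>degree p > 0\<close>
      by (intro antisym dvd_imp_degree_le) auto
    have "k \<noteq> 0"
      using k \<open>degree p > 0\<close> by auto
    hence "degree k = 0"
      using k deg_eq \<open>f \<noteq> 0\<close> by (simp add: degree_mult_eq)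
    moreover have "lead_coeff k = 1"
      using k * monic by (simp add: lead_coeff_mult)
    ultimately have "f = p"
      using k by (auto elim!: degree_eq_zeroE simp: one_pCons)
    with p have min: "is_min_poly \<alpha> f" by simp
    have "\<alpha> \<in> ext_field m"
      using is_Fq_OrderD(2)[OF ord] by (simp add: min_poly_dvd_iff[OF min] frob)
    moreover have "h = 0" if "degree h < m" "poly (map_poly to_ac (q_associate h)) \<alpha> = 0" for h
      using that is_Fq_Order_eq_0[OF ord, of h] by (simp add: min_poly_dvd_iff[OF min] deg)
    ultimately have "normal_element m \<alpha>"
      by (simp add: normal_element_iff[OF assms(2)])
    thus "normal_poly f"
      using min assms by (auto simp: normal_poly_def)
  qed
qed

end
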